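(* Let $X,Y$ be real random variables with respective Stein operators $$A_X = L_X - M^pK_X,\qquad A_Y = L_Y - M^pK_Y,$$ where $p\in\mathbb N$ and where $L_X,K_X,L_Y,K_Y$ are linear differential operators which commute with each other and with every $\tau_a$, $a\in\mathbb R\setminus\{0\}$. If $X$ and $Y$ are independent, then $$L_XL_Y - M^pK_XK_Y$$ is a Stein operator for $XY$.
   Context: Notation: $Mf(x)=xf(x)$, $Df=f'$, and $\tau_af(x)=f(ax)$ for $a\in\mathbb R\setminus\{0\}$; products of operators are compositions. Definition: a linear differential operator $A$ acting on a class $\mathcal F$ of functions is a Stein operator for a random variable $X$ if $Af\in L^1(X)$ (i.e. $\mathbb E|Af(X)|<\infty$) and $\mathbb E[Af(X)]=0$ for all $f\in\mathcal F$. Convention: Stein operators are understood to act on a class containing $C_0^\infty(\mathbb R)$, the smooth compactly supported functions on $\mathbb R$; thus "A is a Stein operator for $X$" means that $Af(X)$ is integrable with mean zero for every $f\in C_0^\infty(\mathbb R)$. Standing assumption: the random variables $X,Y$ each have a density with respect to Lebesgue measure that is smooth and non-vanishing on some (possibly unbounded) interval $J\subseteq\mathbb R$ (depending on the variable), which is its support. *)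

theory Defs
  imports "HOL-Probability.Probability"
begin

text \<open>Iterated derivatives are taken with the total function \<^const>\<open>deriv\<close>, so that this is the
  usual notion of a \<open>C\<^sup>\<infinity>\<close> function only when \<open>S\<close> is open.\<close>

definition smooth_on :: "real set \<Rightarrow> (real \<Rightarrow> real) \<Rightarrow> bool" where
  "smooth_on S f \<longleftrightarrow> (\<forall>k. (deriv ^^ k) f differentiable_on S)"

definition test_functions :: "(real \<Rightarrow> real) set" where
  "test_functions = {f. smooth_on UNIV f \<and> compact (closure {x. f x \<noteq> 0})}"

definition mult_op :: "(real \<Rightarrow> real) \<Rightarrow> real \<Rightarrow> real" where
  "mult_op f = (\<lambda>x. x * f x)"

definition dilation :: "real \<Rightarrow> (real \<Rightarrow> real) \<Rightarrow> real \<Rightarrow> real" where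
  "dilation a f = (\<lambda>x. f (a * x))"

text \<open>Operators are total on \<^typ>\<open>real \<Rightarrow> real\<close>; their values at non-smooth functions are
  irrelevant and left unconstrained.\<close>

definition linear_differential_operator :: "((real \<Rightarrow> real) \<Rightarrow> real \<Rightarrow> real) \<Rightarrow> bool" where
  "linear_differential_operator A \<longleftrightarrow>
     (\<exists>n (a :: nat \<Rightarrow> real \<Rightarrow> real). (\<forall>k\<le>n. smooth_on UNIV (a k)) \<and>
        (\<forall>f. smooth_on UNIV f \<longrightarrow> A f = (\<lambda>x. \<Sum>k\<le>n. a k x * (deriv ^^ k) f x)))"

definition operators_commute ::
  "((real \<Rightarrow> real) \<Rightarrow> real \<Rightarrow> real) \<Rightarrow> ((real \<Rightarrow> real) \<Rightarrow> real \<Rightarrow> real) \<Rightarrow> bool" where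
  "operators_commute A B \<longleftrightarrow> (\<forall>f\<in>test_functions. (A \<circ> B) f = (B \<circ> A) f)"

definition stein_operator ::
  "'w measure \<Rightarrow> ('w \<Rightarrow> real) \<Rightarrow> ((real \<Rightarrow> real) \<Rightarrow> real \<Rightarrow> real) \<Rightarrow> bool" where
  "stein_operator M X A \<longleftrightarrow> linear_differential_operator A \<and>
     (\<forall>f\<in>test_functions. integrable M (\<lambda>w. A f (X w)) \<and> (\<integral>w. A f (X w) \<partial>M) = 0)"

text \<open>The interval may be open, closed or half-open, bounded or not. A density is determined only
  up to null sets, so it is normalised to vanish exactly outside the interval, and
  differentiability is not imposed at end points.\<close>

definition has_smooth_density :: "'w measure \<Rightarrow> ('w \<Rightarrow> real) \<Rightarrow> bool" where
  "has_smooth_density M X \<longleftrightarrow>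
     (\<exists>(J :: real set) g. is_interval J \<and> (\<forall>x. 0 \<le> g x) \<and> {x. g x \<noteq> 0} = J \<and>
        smooth_on (interior J) g \<and> distributed M lborel X (\<lambda>x. ennreal (g x)))"

end

theory Submission
  imports Defs
begin

text \<open>An operator commuting with all dilations is a linear combination of the Euler operators
  \<open>x\<^sup>k D\<^sup>k\<close>. Conditioning on \<open>Y\<close> and applying the Stein identity of \<open>X\<close>, then conditioning on \<open>X\<close> and
  applying that of \<open>Y\<close>, formally gives the claim, but the intermediate quantity
  \<open>X\<^sup>p (K\<^sub>X L\<^sub>Y f)(X Y)\<close> need not be integrable, so that Fubini's theorem does not apply to it.
  Therefore \<open>f(\<cdot> y)\<close> is first multiplied by a cutoff \<open>\<chi>(r x)\<close>. By the Leibniz rule the operators in \<open>x\<close>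
  turn this product into a finite sum of terms \<open>(x\<^sup>j \<chi>\<^sup>(\<^sup>j\<^sup>))(r x) \<cdot> (z\<^sup>i f\<^sup>(\<^sup>i\<^sup>))(x y)\<close>, on each of which the Stein
  identity of \<open>Y\<close> still acts, since Euler operators commute. The outer two members of the resulting
  chain of equalities are bounded uniformly in \<open>r\<close>, so one may let \<open>r \<rightarrow> 0\<close>.\<close>

subsection \<open>Smooth functions and test functions\<close>

lemma smooth_on_UNIV_iff:
  "smooth_on UNIV f \<longleftrightarrow>
     (\<forall>k x. ((deriv ^^ k) f has_real_derivative (deriv ^^ Suc k) f x) (at x))"
proof
  assume "smooth_on UNIV f"
  then show "\<forall>k x. ((deriv ^^ k) f has_real_derivative (deriv ^^ Suc k) f x) (at x)"
    by (auto simp: smooth_on_def differentiable_on_def real_differentiable_def dest: DERIV_imp_deriv)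
next
  assume "\<forall>k x. ((deriv ^^ k) f has_real_derivative (deriv ^^ Suc k) f x) (at x)"
  then show "smooth_on UNIV f"
    unfolding smooth_on_def differentiable_on_def real_differentiable_def by blast
qed

lemma smooth_higher_deriv:
  "smooth_on UNIV f \<Longrightarrow>
     ((deriv ^^ k) f has_real_derivative (deriv ^^ Suc k) f x) (at x)"
  by (simp only: smooth_on_UNIV_iff)

lemma smooth_has_deriv: "smooth_on UNIV f \<Longrightarrow> (f has_real_derivative deriv f x) (at x)"
  using smooth_higher_deriv[of f 0 x] by simp

lemma smooth_deriv_funpow: "smooth_on UNIV f \<Longrightarrow> smooth_on UNIV ((deriv ^^ k) f)"
  unfolding smooth_on_def by (metis comp_apply funpow_add)

lemma smooth_deriv: "smooth_on UNIV f \<Longrightarrow> smooth_on UNIV (deriv f)"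
  using smooth_deriv_funpow[of f 1] by simp

lemma smooth_continuous_on: "smooth_on UNIV f \<Longrightarrow> continuous_on S f"
  by (meson DERIV_isCont continuous_at_imp_continuous_on smooth_has_deriv)

text \<open>Derivatives are unique, so the witness \<open>f'\<close> is \<open>deriv f\<close>;
  hence \<open>P\<close> passes to every iterate of \<open>deriv\<close>, and each iterate is
  differentiable. To prove smoothness it thus suffices to exhibit one derivative inside the class,
  without a formula for the k-th one.\<close>

lemma smooth_coinduct:
  assumes "P f"
    and step: "\<And>f. P f \<Longrightarrow> \<exists>f'. (\<forall>x. (f has_real_derivative f' x) (at x)) \<and> P f'"
  shows "smooth_on UNIV f"
proof -
  have step': "P (deriv g) \<and> (\<forall>x. (g has_real_derivative deriv g x) (at x))" if g: "P g" for g
  proof -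
    obtain g' where g': "\<forall>x. (g has_real_derivative g' x) (at x)" "P g'"
      using step[OF g] by blast
    then have "deriv g = g'" by (auto intro: DERIV_imp_deriv)
    with g' show ?thesis by simp
  qed
  have "P ((deriv ^^ k) f)" for k
    by (induction k) (simp_all add: assms(1) step')
  then show ?thesis
    unfolding smooth_on_UNIV_iff using step' by simp
qed

text \<open>The classical smooth function exp(-1/x) is the case n = 0. The powers in the denominator
  make the family closed under differentiation up to linear combinations, as the coinduction
  requires.\<close>

definition flat :: "nat \<Rightarrow> real \<Rightarrow> real" where
  "flat n x = (if x > 0 then exp (- 1 / x) / x ^ n else 0)"

text \<open>From the right, the substitution t = 1/x turns the claim into the decay of t^n / e^t at
  infinity.\<close>

lemma flat_tendsto: "(flat n \<longlongrightarrow> 0) (at 0)"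
proof -
  have "((\<lambda>t::real. t ^ n / exp t) \<longlongrightarrow> 0) at_top"
    by (rule tendsto_power_div_exp_0)
  then have "((\<lambda>x::real. inverse x ^ n / exp (inverse x)) \<longlongrightarrow> 0) (at_right 0)"
    by (rule filterlim_compose) (rule filterlim_inverse_at_top_right)
  then have r: "(flat n \<longlongrightarrow> 0) (at_right 0)"
    by (rule Lim_transform_eventually)
      (auto simp: flat_def eventually_at_filter exp_minus field_simps)
  have l: "(flat n \<longlongrightarrow> 0) (at_left 0)"
    by (rule Lim_transform_eventually[OF tendsto_const])
      (auto simp: flat_def eventually_at_filter)
  show ?thesis using l r filterlim_split_at by blast
qed

lemma flat_has_deriv:
  "(flat n has_real_derivative flat (n + 2) x - real n * flat (n + 1) x) (at x)"
proof -
  consider "x > 0" | "x < 0" | "x = 0" by linarith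
  then show ?thesis
  proof cases
    case 1
    have "((\<lambda>x. exp (- 1 / x) / x ^ n) has_real_derivative
        (exp (- 1 / x) / x\<^sup>2 * x ^ n - exp (- 1 / x) * (real n * x ^ (n - 1))) / (x ^ n * x ^ n)) (at x)"
      using 1 by (auto intro!: derivative_eq_intros simp: power2_eq_square)
    also have "(exp (- 1 / x) / x\<^sup>2 * x ^ n - exp (- 1 / x) * (real n * x ^ (n - 1))) / (x ^ n * x ^ n) =
        flat (n + 2) x - real n * flat (n + 1) x"
      \<comment> \<open>The exponent n - 1 is truncated at n = 0, where the factor
        \<open>real n\<close> kills the term.\<close>
      using 1 by (cases n) (auto simp: flat_def field_simps power2_eq_square)
    finally have "((\<lambda>x. exp (- 1 / x) / x ^ n) has_real_derivative
        flat (n + 2) x - real n * flat (n + 1) x) (at x)" .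
    then show ?thesis
      by (rule has_field_derivative_transform_within_open[of _ _ _ "{0<..}"])
        (use 1 in \<open>auto simp: flat_def\<close>)
  next
    case 2
    have "((\<lambda>x. 0) has_real_derivative flat (n + 2) x - real n * flat (n + 1) x) (at x)"
      using 2 by (simp add: flat_def)
    then show ?thesis
      by (rule has_field_derivative_transform_within_open[of _ _ _ "{..<0}"])
        (use 2 in \<open>auto simp: flat_def\<close>)
  next
    case 3
    \<comment> \<open>The difference quotient of \<open>flat n\<close> at 0 is
      \<open>flat (Suc n)\<close>, whose limit is already known.\<close>
    have "((\<lambda>h. (flat n (0 + h) - flat n 0) / h) \<longlongrightarrow> 0) (at 0)"
      by (rule Lim_transform_eventually[OF flat_tendsto[of "Suc n"]])
        (auto simp: flat_def eventually_at_filter)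
    then show ?thesis
      using 3 by (simp add: DERIV_def flat_def)
  qed
qed

text \<open>Closing the smooth functions under all operations of interest at once keeps the
  coinductive proof of smoothness short: the derivative of a member is again a member.\<close>

inductive smooth_closure :: "(real \<Rightarrow> real) \<Rightarrow> bool" where
  base: "smooth_on UNIV f \<Longrightarrow> smooth_closure f"
| const: "smooth_closure (\<lambda>x. c)"
| ident: "smooth_closure (\<lambda>x. x)"
| flat: "smooth_closure (flat n)"
| add: "smooth_closure f \<Longrightarrow> smooth_closure g \<Longrightarrow> smooth_closure (\<lambda>x. f x + g x)"
| mult: "smooth_closure f \<Longrightarrow> smooth_closure g \<Longrightarrow> smooth_closure (\<lambda>x. f x * g x)"
| inverse: "smooth_closure f \<Longrightarrow> (\<And>x. f x \<noteq> 0) \<Longrightarrow> smooth_closure (\<lambda>x. inverse (f x))"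
| comp: "smooth_on UNIV f \<Longrightarrow> smooth_closure g \<Longrightarrow> smooth_closure (\<lambda>x. f (g x))"

lemma smooth_closure_has_deriv:
  "smooth_closure f \<Longrightarrow> \<exists>f'. (\<forall>x. (f has_real_derivative f' x) (at x)) \<and> smooth_closure f'"
proof (induction rule: smooth_closure.induct)
  case (base f)
  then show ?case
    using smooth_has_deriv smooth_closure.base[OF smooth_deriv] by blast
next
  case (const c)
  show ?case by (rule exI[of _ "\<lambda>x. 0"]) (auto intro: smooth_closure.const)
next
  case ident
  show ?case by (rule exI[of _ "\<lambda>x. 1"]) (auto intro: smooth_closure.const)
next
  case (flat n)
  have "smooth_closure (\<lambda>x. flat (n + 2) x + (- real n) * flat (n + 1) x)"
    by (intro smooth_closure.add smooth_closure.mult smooth_closure.const smooth_closure.flat)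
  with flat_has_deriv[of n] show ?case by force
next
  case (add f g)
  then obtain f' g' where
    "\<forall>x. (f has_real_derivative f' x) (at x)" "smooth_closure f'"
    "\<forall>x. (g has_real_derivative g' x) (at x)" "smooth_closure g'" by blast
  then show ?case
    by (intro exI[of _ "\<lambda>x. f' x + g' x"]) (auto intro!: derivative_intros smooth_closure.add)
next
  case (mult f g)
  then obtain f' g' where
    "\<forall>x. (f has_real_derivative f' x) (at x)" "smooth_closure f'"
    "\<forall>x. (g has_real_derivative g' x) (at x)" "smooth_closure g'" by blast
  with mult show ?case
    by (intro exI[of _ "\<lambda>x. f' x * g x + g' x * f x"])
      (auto intro!: DERIV_mult smooth_closure.add smooth_closure.mult)
next
  case (inverse f)
  then obtain f' where
    f': "\<forall>x. (f has_real_derivative f' x) (at x)" "smooth_closure f'" by blast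
  with inverse(1,2) have "smooth_closure (\<lambda>x. (-1) * (inverse (f x) * f' x * inverse (f x)))"
    by (intro smooth_closure.mult smooth_closure.const smooth_closure.inverse)
  with f'(1) inverse(2) show ?case
    by (intro exI[of _ "\<lambda>x. (-1) * (inverse (f x) * f' x * inverse (f x))"])
      (auto intro!: DERIV_inverse')
next
  case (comp f g)
  then obtain g' where
    g': "\<forall>x. (g has_real_derivative g' x) (at x)" "smooth_closure g'" by blast
  have "smooth_closure (\<lambda>x. deriv f (g x) * g' x)"
    by (rule smooth_closure.mult[OF smooth_closure.comp[OF smooth_deriv[OF comp(1)] comp(2)] g'(2)])
  moreover have "((\<lambda>x. f (g x)) has_real_derivative deriv f (g x) * g' x) (at x)" for x
    by (rule DERIV_chain2[OF smooth_has_deriv[OF comp(1)] g'(1)[rule_format]])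
  ultimately show ?case by (intro exI[of _ "\<lambda>x. deriv f (g x) * g' x"]) simp
qed

text \<open>The closure adds no new functions, so its introduction rules turn into closure rules for
  smoothness itself.\<close>

lemma smooth_closure_iff: "smooth_closure f \<longleftrightarrow> smooth_on UNIV f"
  using smooth_coinduct[of smooth_closure f] smooth_closure_has_deriv smooth_closure.base by blast

lemmas smooth_intros = smooth_closure.intros(2-7)[unfolded smooth_closure_iff]
lemmas smooth_compose = smooth_closure.comp[unfolded smooth_closure_iff]

lemma smooth_minus: "smooth_on UNIV f \<Longrightarrow> smooth_on UNIV g \<Longrightarrow> smooth_on UNIV (\<lambda>x. f x - g x)"
  using smooth_intros(4)[of f "\<lambda>x. (-1) * g x"] smooth_intros(5)[OF smooth_intros(1)[of "-1"], of g]
  by simp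

lemma smooth_power: "smooth_on UNIV f \<Longrightarrow> smooth_on UNIV (\<lambda>x. f x ^ n)"
  by (induction n) (auto intro: smooth_intros)

lemma smooth_sum:
  "(\<And>i. i \<in> I \<Longrightarrow> smooth_on UNIV (f i)) \<Longrightarrow> smooth_on UNIV (\<lambda>x. \<Sum>i\<in>I. f i x)"
  by (induction I rule: infinite_finite_induct) (auto intro: smooth_intros)

lemma smooth_dilation: "smooth_on UNIV f \<Longrightarrow> smooth_on UNIV (dilation a f)"
  unfolding dilation_def by (rule smooth_compose) (auto intro: smooth_intros)

text \<open>The numerator vanishes for |x| >= 2 and the other term of the denominator for |x| <= 1,
  so the quotient is 1 on [-1, 1] and 0 outside (-2, 2). The denominator is positive because 4 - x^2
  and x^2 - 1 are never both nonpositive. Squares replace |x| to keep the arguments smooth.\<close>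

definition cutoff :: "real \<Rightarrow> real" where
  "cutoff x = flat 0 (4 - x\<^sup>2) * inverse (flat 0 (4 - x\<^sup>2) + flat 0 (x\<^sup>2 - 1))"

lemma smooth_cutoff: "smooth_on UNIV cutoff"
proof -
  have "flat 0 (4 - x\<^sup>2) + flat 0 (x\<^sup>2 - 1) \<noteq> 0" for x
  proof -
    have "flat 0 (4 - x\<^sup>2) \<ge> 0" "flat 0 (x\<^sup>2 - 1) \<ge> 0"
      "flat 0 (4 - x\<^sup>2) > 0 \<or> flat 0 (x\<^sup>2 - 1) > 0"
      by (auto simp: flat_def)
    then show ?thesis by linarith
  qed
  moreover have "smooth_on UNIV (\<lambda>x. flat 0 (4 - x\<^sup>2))" "smooth_on UNIV (\<lambda>x. flat 0 (x\<^sup>2 - 1))"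
    by (rule smooth_compose[of "flat 0"]; intro smooth_minus smooth_power smooth_intros)+
  ultimately show ?thesis
    unfolding cutoff_def[abs_def] by (intro smooth_intros(5,6) smooth_intros(4))
qed

lemma cutoff_eq_1: "\<bar>x\<bar> \<le> 1 \<Longrightarrow> cutoff x = 1"
  using abs_square_le_1[of x] by (auto simp: cutoff_def flat_def)

lemma cutoff_eq_0: "2 \<le> \<bar>x\<bar> \<Longrightarrow> cutoff x = 0"
  using power_mono[of 2 "\<bar>x\<bar>" 2] by (auto simp: cutoff_def flat_def)

section \<open>Locality of derivatives; compactly supported smooth functions\<close>

lemma deriv_funpow_eqI:
  assumes "open S" "x \<in> S" "\<And>y. y \<in> S \<Longrightarrow> f y = g y"
  shows "(deriv ^^ k) f x = (deriv ^^ k) g (x::real)"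
  using assms
proof (induction k arbitrary: x)
  case (Suc k)
  have "eventually (\<lambda>y. (deriv ^^ k) f y = (deriv ^^ k) g y) (nhds x)"
    using Suc eventually_nhds by blast
  then show ?case by (auto intro: deriv_cong_ev)
qed simp

lemma test_functions_iff:
  "f \<in> test_functions \<longleftrightarrow> smooth_on UNIV f \<and> (\<exists>R. \<forall>x. \<bar>x\<bar> > R \<longrightarrow> f x = 0)"
proof -
  have "(\<exists>R. \<forall>x\<in>{x. f x \<noteq> 0}. norm x \<le> R) \<longleftrightarrow> (\<exists>R. \<forall>x. \<bar>x\<bar> > R \<longrightarrow> f x = 0)"
    by (intro ex_cong1) (auto simp: not_less[symmetric])
  then show ?thesis
    by (simp only: test_functions_def mem_Collect_eq compact_closure bounded_iff)
qed

lemma test_functionsI: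
  "smooth_on UNIV f \<Longrightarrow> (\<And>x. \<bar>x\<bar> > R \<Longrightarrow> f x = 0) \<Longrightarrow> f \<in> test_functions"
  unfolding test_functions_iff by blast

lemma test_functions_smooth: "f \<in> test_functions \<Longrightarrow> smooth_on UNIV f"
  unfolding test_functions_iff by blast

lemma test_functions_mult:
  assumes "f \<in> test_functions" "smooth_on UNIV g"
  shows "(\<lambda>x. g x * f x) \<in> test_functions"
  using assms unfolding test_functions_iff by (auto intro!: smooth_intros)

lemma test_functions_sum:
  assumes "finite I" "\<And>i. i \<in> I \<Longrightarrow> f i \<in> test_functions"
  shows "(\<lambda>x. \<Sum>i\<in>I. f i x) \<in> test_functions"
proof -
  obtain R where R: "\<And>i x. i \<in> I \<Longrightarrow> \<bar>x\<bar> > R i \<Longrightarrow> f i x = 0"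
    using assms(2) unfolding test_functions_iff by metis
  show ?thesis
  proof (rule test_functionsI)
    show "smooth_on UNIV (\<lambda>x. \<Sum>i\<in>I. f i x)"
      using assms(2) by (intro smooth_sum test_functions_smooth)
    \<comment> \<open>The sum of the absolute radii dominates each radius and, unlike a maximum,
      makes sense for empty \<open>I\<close>.\<close>
    fix x assume x: "\<bar>x\<bar> > (\<Sum>i\<in>I. \<bar>R i\<bar>)"
    have "f i x = 0" if "i \<in> I" for i
      using member_le_sum[of i I "\<lambda>i. \<bar>R i\<bar>"] that assms(1) x by (intro R) auto
    then show "(\<Sum>i\<in>I. f i x) = 0" by simp
  qed
qed

text \<open>The strict inequality |x| > R describes an open set, so the function agrees with 0 near
  each of its points and the same radius serves for every derivative.\<close>

lemma test_functions_deriv_funpow: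
  assumes "f \<in> test_functions" shows "(deriv ^^ k) f \<in> test_functions"
proof -
  obtain R where R: "\<forall>x. \<bar>x\<bar> > R \<longrightarrow> f x = 0" and s: "smooth_on UNIV f"
    using assms unfolding test_functions_iff by blast
  show ?thesis
  proof (rule test_functionsI)
    show "smooth_on UNIV ((deriv ^^ k) f)" using s by (rule smooth_deriv_funpow)
    fix x :: real assume x: "\<bar>x\<bar> > R"
    have 0: "(deriv ^^ k) (\<lambda>x. 0) = (\<lambda>x. 0 :: real)" by (induction k) auto
    have "open {x::real. R < \<bar>x\<bar>}" by (intro open_Collect_less continuous_intros)
    then have "(deriv ^^ k) f x = (deriv ^^ k) (\<lambda>x. 0) x"
      by (rule deriv_funpow_eqI) (use R x in auto)
    then show "(deriv ^^ k) f x = 0" by (simp add: 0)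
  qed
qed

lemma test_functions_dilation:
  assumes "f \<in> test_functions" "a \<noteq> 0" shows "dilation a f \<in> test_functions"
proof -
  obtain R where R: "\<forall>x. \<bar>x\<bar> > R \<longrightarrow> f x = 0" and s: "smooth_on UNIV f"
    using assms unfolding test_functions_iff by blast
  show ?thesis
  proof (rule test_functionsI)
    show "dilation a f x = 0" if "\<bar>x\<bar> > R / \<bar>a\<bar>" for x
      using R that assms(2) by (auto simp: dilation_def abs_mult field_simps)
  qed (rule smooth_dilation[OF s])
qed

lemma test_functions_bounded:
  assumes "f \<in> test_functions" obtains B where "\<And>x. \<bar>f x\<bar> \<le> B"
proof -
  obtain R where R: "\<forall>x. \<bar>x\<bar> > R \<longrightarrow> f x = 0" and s: "smooth_on UNIV f"
    using assms unfolding test_functions_iff by blast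
  have "compact (f ` {-R..R})"
    by (intro compact_continuous_image smooth_continuous_on s) auto
  then obtain B where B: "\<And>x. x \<in> {-R..R} \<Longrightarrow> \<bar>f x\<bar> \<le> B"
    using compact_imp_bounded[of "f ` {-R..R}"] unfolding bounded_iff by force
  \<comment> \<open>The maximum is needed because \<open>B\<close> may be negative when the interval
    is empty.\<close>
  have "\<bar>f x\<bar> \<le> max B 0" for x
  proof (cases "\<bar>x\<bar> > R")
    case False
    then have "x \<in> {-R..R}" by auto
    then show ?thesis using B by (auto simp: le_max_iff_disj)
  qed (use R in simp)
  then show ?thesis using that by blast
qed

lemma test_functions_cutoff: "cutoff \<in> test_functions"
  by (rule test_functionsI[of _ 2]) (auto intro: smooth_cutoff cutoff_eq_0)

section \<open>Higher derivatives of dilations, products and powers\<close>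

lemma deriv_funpow_affine:
  assumes "smooth_on UNIV f"
  shows "(deriv ^^ k) (\<lambda>x. f (a * x)) = (\<lambda>x. a ^ k * (deriv ^^ k) f (a * x))"
proof (induction k)
  case (Suc k)
  have "((\<lambda>x. a ^ k * (deriv ^^ k) f (a * x)) has_real_derivative
      a ^ Suc k * (deriv ^^ Suc k) f (a * x)) (at x)" for x
    using DERIV_cmult[OF DERIV_chain2[OF smooth_higher_deriv[OF assms, of k "a * x"]
      DERIV_cmult_Id[of a x UNIV]], of "a ^ k"]
    by (simp add: mult_ac)
  then have "deriv (\<lambda>x. a ^ k * (deriv ^^ k) f (a * x)) =
      (\<lambda>x. a ^ Suc k * (deriv ^^ Suc k) f (a * x))"
    by (auto intro: DERIV_imp_deriv)
  then show ?case using Suc by simp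
qed simp

lemma deriv_funpow_mult:
  assumes "smooth_on UNIV f" "smooth_on UNIV g"
  shows "(deriv ^^ n) (\<lambda>x. f x * g x) =
    (\<lambda>x. \<Sum>j\<le>n. of_nat (n choose j) * (deriv ^^ j) f x * (deriv ^^ (n - j)) g x)"
proof (induction n)
  case (Suc n)
  let ?f = "\<lambda>j. (deriv ^^ j) f" and ?g = "\<lambda>j. (deriv ^^ j) g"
  have D: "((\<lambda>x. \<Sum>j\<le>n. of_nat (n choose j) * ?f j x * ?g (n - j) x) has_real_derivative
      (\<Sum>j\<le>n. of_nat (n choose j) * (?f (Suc j) x * ?g (n - j) x + ?f j x * ?g (Suc n - j) x))) (at x)"
    for x
    unfolding mult.assoc
    by (intro DERIV_sum DERIV_cmult)
      (auto simp: Suc_diff_le simp del: funpow.simps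
        intro!: derivative_eq_intros smooth_higher_deriv assms)
  have S: "(\<Sum>j\<le>n. of_nat (n choose j) * (?f (Suc j) x * ?g (n - j) x + ?f j x * ?g (Suc n - j) x)) =
      (\<Sum>j\<le>Suc n. of_nat (Suc n choose j) * ?f j x * ?g (Suc n - j) x)" for x
  proof -
    \<comment> \<open>Running the sum up to \<open>Suc n\<close> is harmless since n choose n + 1 is
      0; after the index shift Pascal's rule matches the coefficients.\<close>
    have "(\<Sum>j\<le>Suc n. of_nat (n choose j) * ?f j x * ?g (Suc n - j) x) =
        ?f 0 x * ?g (Suc n) x + (\<Sum>j\<le>n. of_nat (n choose Suc j) * ?f (Suc j) x * ?g (n - j) x)"
      by (subst sum.atMost_Suc_shift) simp
    moreover have "(\<Sum>j\<le>Suc n. of_nat (Suc n choose j) * ?f j x * ?g (Suc n - j) x) =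
        ?f 0 x * ?g (Suc n) x + (\<Sum>j\<le>n. of_nat (Suc n choose Suc j) * ?f (Suc j) x * ?g (n - j) x)"
      by (subst sum.atMost_Suc_shift) simp
    moreover have "(\<Sum>j\<le>n. of_nat (n choose j) * (?f (Suc j) x * ?g (n - j) x + ?f j x * ?g (Suc n - j) x)) =
        (\<Sum>j\<le>n. of_nat (n choose j) * ?f (Suc j) x * ?g (n - j) x) +
        (\<Sum>j\<le>Suc n. of_nat (n choose j) * ?f j x * ?g (Suc n - j) x)"
      by (simp only: sum.atMost_Suc binomial_eq_0 lessI of_nat_0 mult_zero_left add_0_right
        flip: sum.distrib) (simp only: distrib_left mult.assoc)
    moreover have "(\<Sum>j\<le>n. of_nat (Suc n choose Suc j) * ?f (Suc j) x * ?g (n - j) x) =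
        (\<Sum>j\<le>n. of_nat (n choose j) * ?f (Suc j) x * ?g (n - j) x) +
        (\<Sum>j\<le>n. of_nat (n choose Suc j) * ?f (Suc j) x * ?g (n - j) x)"
      by (simp only: binomial_Suc_Suc of_nat_add distrib_right sum.distrib)
    ultimately show ?thesis by linarith
  qed
  show ?case
    unfolding funpow.simps comp_apply Suc
    by (rule ext) (simp only: DERIV_imp_deriv[OF D] S[unfolded funpow.simps comp_apply] funpow.simps comp_apply)
qed simp

text \<open>The falling factorial is taken over the reals: for j > k it contains the factor 0, so
  the formula stays right although \<open>k - j\<close> is truncated.\<close>

lemma deriv_funpow_shifted_power:
  "(deriv ^^ j) (\<lambda>x::real. (x - c) ^ k) =
     (\<lambda>x. (\<Prod>i<j. real k - real i) * (x - c) ^ (k - j))"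
proof (induction j)
  case (Suc j)
  have "((\<lambda>x. (\<Prod>i<j. real k - real i) * (x - c) ^ (k - j)) has_real_derivative
     (\<Prod>i<Suc j. real k - real i) * (x - c) ^ (k - Suc j)) (at x)" for x
  proof (cases "j < k")
    case True
    then show ?thesis
      by (auto intro!: derivative_eq_intros simp: of_nat_diff)
  next
    case False
    then have "(\<Prod>i<Suc j. real k - real i) = 0"
      by (intro prod_zero) (auto intro!: bexI[of _ k])
    moreover have "(\<lambda>x. (\<Prod>i<j. real k - real i) * (x - c) ^ (k - j)) =
        (\<lambda>x. \<Prod>i<j. real k - real i)"
      using False by simp
    ultimately show ?thesis
      by (simp only: DERIV_const mult_zero_left)
  qed
  then show ?case using Suc by (auto intro!: DERIV_imp_deriv)
qed simp

subsection \<open>Euler operators and dilation-invariant differential operators\<close>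

definition euler :: "nat \<Rightarrow> (real \<Rightarrow> real) \<Rightarrow> real \<Rightarrow> real" where
  "euler k f = (\<lambda>x. x ^ k * (deriv ^^ k) f x)"

lemma smooth_euler: "smooth_on UNIV f \<Longrightarrow> smooth_on UNIV (euler k f)"
  unfolding euler_def by (intro smooth_intros smooth_power smooth_deriv_funpow)

lemma test_functions_euler: "f \<in> test_functions \<Longrightarrow> euler k f \<in> test_functions"
  unfolding euler_def
  by (intro test_functions_mult test_functions_deriv_funpow smooth_power smooth_intros)

text \<open>The chain rule contributes a^k, which combines with x^k to (a x)^k.\<close>

lemma euler_dilation:
  "smooth_on UNIV f \<Longrightarrow> euler k (dilation a f) = dilation a (euler k f)"
  by (auto simp: euler_def dilation_def deriv_funpow_affine power_mult_distrib)

text \<open>In Leibniz' rule x^n splits as x^j x^(n-j), so the expansion again involves Euler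
  operators only.\<close>

lemma euler_mult:
  assumes "smooth_on UNIV f" "smooth_on UNIV g"
  shows "euler n (\<lambda>x. f x * g x) =
    (\<lambda>x. \<Sum>j\<le>n. of_nat (n choose j) * euler j f x * euler (n - j) g x)"
proof
  fix x :: real
  have "x ^ n * (of_nat (n choose j) * (deriv ^^ j) f x * (deriv ^^ (n - j)) g x) =
      of_nat (n choose j) * euler j f x * euler (n - j) g x" if "j \<le> n" for j
    using power_add[of x j "n - j"] that by (simp add: euler_def)
  then show "euler n (\<lambda>x. f x * g x) x =
      (\<Sum>j\<le>n. of_nat (n choose j) * euler j f x * euler (n - j) g x)"
    unfolding euler_def[of n "\<lambda>x. f x * g x"] deriv_funpow_mult[OF assms] sum_distrib_left
    by (intro sum.cong) auto
qed

text \<open>This exhibits each Euler operator as a polynomial in x D, namely x D (x D - 1) ... (x D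
  - k + 1). Linearity and commutation then reduce to \<open>euler 1\<close> by induction.\<close>

lemma euler_Suc:
  assumes "smooth_on UNIV f"
  shows "euler (Suc k) f = (\<lambda>x. euler 1 (euler k f) x - real k * euler k f x)"
proof
  fix x
  have "(euler k f has_real_derivative
      real k * x ^ (k - 1) * (deriv ^^ k) f x + x ^ k * (deriv ^^ Suc k) f x) (at x)"
    unfolding euler_def
    using DERIV_mult[OF DERIV_pow smooth_higher_deriv[OF assms]] by (simp add: mult_ac)
  then have d: "deriv (euler k f) x =
      real k * x ^ (k - 1) * (deriv ^^ k) f x + x ^ k * (deriv ^^ Suc k) f x"
    by (rule DERIV_imp_deriv)
  show "euler (Suc k) f x = euler 1 (euler k f) x - real k * euler k f x"
    unfolding euler_def[of 1] using d
    by (cases k) (simp_all add: euler_def algebra_simps)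
qed

lemma euler_linear:
  assumes "smooth_on UNIV f" "smooth_on UNIV g"
  shows "euler k (\<lambda>x. f x + c * g x) = (\<lambda>x. euler k f x + c * euler k g x)"
proof (induction k)
  case 0 show ?case by (simp add: euler_def)
next
  case (Suc k)
  have 1: "euler 1 (\<lambda>x. u x + c * v x) = (\<lambda>x. euler 1 u x + c * euler 1 v x)"
    if "smooth_on UNIV u" "smooth_on UNIV v" for u v
  proof
    fix x
    have "((\<lambda>x. u x + c * v x) has_real_derivative deriv u x + c * deriv v x) (at x)"
      by (intro DERIV_add DERIV_cmult smooth_has_deriv that)
    then show "euler 1 (\<lambda>x. u x + c * v x) x = euler 1 u x + c * euler 1 v x"
      by (simp add: euler_def DERIV_imp_deriv algebra_simps)
  qed
  have "smooth_on UNIV (\<lambda>x. f x + c * g x)" by (intro smooth_intros assms)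
  then show ?case
    by (simp only: euler_Suc assms Suc 1 smooth_euler) (simp add: algebra_simps)
qed

lemma euler_sum:
  assumes "finite I" "\<And>i. i \<in> I \<Longrightarrow> smooth_on UNIV (f i)"
  shows "euler k (\<lambda>x. \<Sum>i\<in>I. c i * f i x) = (\<lambda>x. \<Sum>i\<in>I. c i * euler k (f i) x)"
  using assms
proof (induction I rule: finite_induct)
  case empty
  have "(deriv ^^ k) (\<lambda>x. 0) = (\<lambda>x. 0 :: real)" by (induction k) auto
  then show ?case by (simp add: euler_def)
next
  case (insert i I)
  have s: "smooth_on UNIV (\<lambda>x. \<Sum>i\<in>I. c i * f i x)" "smooth_on UNIV (f i)"
    using insert by (auto intro!: smooth_sum smooth_intros)
  have "euler k (\<lambda>x. \<Sum>i\<in>insert i I. c i * f i x) =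
      euler k (\<lambda>x. (\<Sum>i\<in>I. c i * f i x) + c i * f i x)"
    using insert.hyps by (simp add: add.commute)
  also have "\<dots> = (\<lambda>x. euler k (\<lambda>x. \<Sum>i\<in>I. c i * f i x) x + c i * euler k (f i) x)"
    by (rule euler_linear[OF s])
  also have "\<dots> = (\<lambda>x. \<Sum>i\<in>insert i I. c i * euler k (f i) x)"
    using insert by (simp add: add.commute)
  finally show ?case .
qed

lemma euler_commute:
  assumes "smooth_on UNIV f"
  shows "euler j (euler k f) = euler k (euler j f)"
  using assms
proof (induction j arbitrary: f k)
  case 0 then show ?case by (simp add: euler_def)
next
  case (Suc j)
  \<comment> \<open>Polynomials in x D commute: first x D with every Euler operator, then, by the
    recursion in \<open>j\<close>, any two of them.\<close>
  have 1: "euler 1 (euler k g) = euler k (euler 1 g)" if "smooth_on UNIV g" for g k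
    using that
  proof (induction k)
    case (Suc k)
    have "euler (Suc k) g = (\<lambda>x. euler 1 (euler k g) x + (- real k) * euler k g x)"
      using euler_Suc[OF Suc.prems, of k] by simp
    then have "euler 1 (euler (Suc k) g) =
        (\<lambda>x. euler 1 (euler 1 (euler k g)) x + (- real k) * euler 1 (euler k g) x)"
      using euler_linear[of "euler 1 (euler k g)" "euler k g" 1 "- real k"]
      by (simp add: smooth_euler Suc.prems)
    also have "\<dots> = euler (Suc k) (euler 1 g)"
      using euler_Suc[of "euler 1 g" k] Suc by (simp add: smooth_euler)
    finally show ?case .
  qed (simp add: euler_def)
  have "euler (Suc j) f = (\<lambda>x. euler 1 (euler j f) x + (- real j) * euler j f x)"
    using euler_Suc[OF Suc.prems, of j] by simp
  then have "euler k (euler (Suc j) f) =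
      (\<lambda>x. euler k (euler 1 (euler j f)) x + (- real j) * euler k (euler j f) x)"
    using euler_linear[of "euler 1 (euler j f)" "euler j f" k "- real j"]
    by (simp add: smooth_euler Suc.prems)
  also have "\<dots> = euler (Suc j) (euler k f)"
  proof -
    have c: "euler k (euler j f) = euler j (euler k f)"
      by (rule Suc.IH[OF Suc.prems, symmetric])
    show ?thesis
      by (simp only: euler_Suc[OF smooth_euler[OF Suc.prems], of j] c
          1[OF smooth_euler[OF Suc.prems], symmetric]) simp
  qed
  finally show ?case by simp
qed

section \<open>Combinations of Euler operators; operators commuting with dilations\<close>

definition euler_operator :: "nat \<Rightarrow> (nat \<Rightarrow> real) \<Rightarrow> (real \<Rightarrow> real) \<Rightarrow> real \<Rightarrow> real" where
  "euler_operator n c f = (\<lambda>x. \<Sum>k\<le>n. c k * euler k f x)"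

lemma smooth_euler_operator: "smooth_on UNIV f \<Longrightarrow> smooth_on UNIV (euler_operator n c f)"
  unfolding euler_operator_def by (intro smooth_sum smooth_intros smooth_euler)

lemma test_functions_euler_operator:
  "f \<in> test_functions \<Longrightarrow> euler_operator n c f \<in> test_functions"
  unfolding euler_operator_def
  by (intro test_functions_sum test_functions_mult test_functions_euler smooth_intros) auto

lemma euler_operator_euler:
  assumes "smooth_on UNIV f"
  shows "euler_operator n c (euler k f) = euler k (euler_operator n c f)"
  using assms
  by (simp add: euler_operator_def euler_sum smooth_euler euler_commute[OF assms, of _ k])

lemma euler_operator_dilation:
  "smooth_on UNIV f \<Longrightarrow> euler_operator n c (dilation a f) = dilation a (euler_operator n c f)"
  by (simp add: euler_operator_def euler_dilation) (simp add: dilation_def)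

text \<open>The monomial (x - c)^k has these derivatives at c. Multiplying by a cutoff equal to 1
  near c keeps them and gives compact support, which matters because commutation is assumed on test
  functions only.\<close>

lemma test_function_with_derivatives:
  obtains f where "f \<in> test_functions"
    "\<And>j. (deriv ^^ j) f c = (if j = k then fact k else (0::real))"
proof
  define f where "f = (\<lambda>x. (x - c) ^ k * cutoff (x - c))"
  have "smooth_on UNIV (\<lambda>x. cutoff (x - c))"
    by (rule smooth_compose[OF smooth_cutoff]) (intro smooth_minus smooth_intros)
  \<comment> \<open>If |x| > 2 + |c| then |x - c| > 2.\<close>
  then have "(\<lambda>x. cutoff (x - c)) \<in> test_functions"
    by (rule test_functionsI[of _ "2 + \<bar>c\<bar>"]) (auto intro!: cutoff_eq_0)
  then show "f \<in> test_functions"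
    unfolding f_def by (rule test_functions_mult) (intro smooth_power smooth_minus smooth_intros)
  fix j
  have "(deriv ^^ j) f c = (deriv ^^ j) (\<lambda>x. (x - c) ^ k) c"
    by (rule deriv_funpow_eqI[of "ball c 1"]) (auto simp: f_def dist_real_def cutoff_eq_1)
  also have "\<dots> = (if j = k then fact k else 0)"
  proof -
    have "(\<Prod>i<k. real k - real i) = fact k"
      by (simp add: fact_prod_rev of_nat_diff atLeast0LessThan)
    moreover have "(\<Prod>i<j. real k - real i) = 0" if "j > k"
      by (rule prod_zero) (use that in auto)
    ultimately show ?thesis
      by (auto simp: deriv_funpow_shifted_power zero_power not_less_iff_gr_or_eq power_0_left)
  qed
  finally show "(deriv ^^ j) f c = (if j = k then fact k else (0::real))" .
qed

text \<open>Testing on functions with prescribed Taylor coefficients at a point shows that the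
  coefficient of \<open>D\<^sup>k\<close> is homogeneous of degree \<open>k\<close>.\<close>

lemma dilation_invariant_operator:
  assumes L: "linear_differential_operator L"
    and comm: "\<And>a. a \<noteq> 0 \<Longrightarrow> operators_commute L (dilation a)"
  obtains n c where "\<And>f. smooth_on UNIV f \<Longrightarrow> L f = euler_operator n c f"
proof -
  obtain n a where a: "\<And>k. k \<le> n \<Longrightarrow> smooth_on UNIV (a k)"
    and La: "\<And>f. smooth_on UNIV f \<Longrightarrow> L f = (\<lambda>x. \<Sum>k\<le>n. a k x * (deriv ^^ k) f x)"
    using L unfolding linear_differential_operator_def by blast
  have hom: "a k c = a k 1 * c ^ k" if "k \<le> n" "c \<noteq> 0" for k c
  proof -
    obtain f where f: "f \<in> test_functions"
      and D: "\<And>j. (deriv ^^ j) f c = (if j = k then fact k else (0::real))"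
      using test_function_with_derivatives[of c k] by metis
    have s: "smooth_on UNIV f" using f by (rule test_functions_smooth)
    \<comment> \<open>At the point 1 the left side involves the coefficients at 1 and the right side
      those at c; the chosen Taylor data isolate the index k on both sides.\<close>
    have "L (dilation c f) 1 = dilation c (L f) 1"
      using comm[OF \<open>c \<noteq> 0\<close>] f unfolding operators_commute_def by (metis comp_apply)
    moreover have "L (dilation c f) 1 = (\<Sum>j\<le>n. a j 1 * (c ^ j * (deriv ^^ j) f c))"
      unfolding La[OF smooth_dilation[OF s]] by (simp add: dilation_def[abs_def] deriv_funpow_affine[OF s])
    moreover have "\<dots> = (\<Sum>j\<le>n. if j = k then a k 1 * (c ^ k * fact k) else 0)"
      by (intro sum.cong) (auto simp: D)
    moreover have "dilation c (L f) 1 = (\<Sum>j\<le>n. if j = k then a k c * fact k else 0)"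
      unfolding dilation_def La[OF s] by (intro sum.cong) (auto simp: D)
    ultimately show ?thesis using \<open>k \<le> n\<close> by simp
  qed
  have a_eq: "a k x = a k 1 * x ^ k" if k: "k \<le> n" for k x
  proof (cases "x = 0")
    \<comment> \<open>The scaling factor 0 is excluded, so the identity at 0 is obtained from the
      continuity of both sides.\<close>
    case True
    have "isCont (a k) 0" "isCont (\<lambda>c. a k 1 * c ^ k) 0"
      using smooth_continuous_on[OF a[OF k], of UNIV] by (auto simp: continuous_on_eq_continuous_at)
    then have l: "(a k \<longlongrightarrow> a k 0) (at 0)" and
      r: "((\<lambda>c. a k 1 * c ^ k) \<longlongrightarrow> a k 1 * 0 ^ k) (at 0)"
      unfolding isCont_def by auto
    have "eventually (\<lambda>c. a k 1 * c ^ k = a k c) (at 0)"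
      unfolding eventually_at_filter by (rule always_eventually) (use hom[OF k] in metis)
    with r have "(a k \<longlongrightarrow> a k 1 * 0 ^ k) (at 0)" by (rule Lim_transform_eventually)
    from tendsto_unique[OF trivial_limit_at l this] show ?thesis by (simp only: True)
  qed (rule hom[OF k])
  have "L f = euler_operator n (\<lambda>k. a k 1) f" if "smooth_on UNIV f" for f
    unfolding La[OF that] euler_operator_def euler_def mult.assoc[symmetric]
    by (intro ext sum.cong refl arg_cong2[where f = "(*)"] a_eq) simp
  then show ?thesis by (rule that)
qed

section \<open>Sums, multiples and compositions of linear differential operators\<close>

lemma linear_differential_operator_cong:
  assumes "linear_differential_operator B" "\<And>f. smooth_on UNIV f \<Longrightarrow> A f = B f"
  shows "linear_differential_operator A"
proof -
  obtain n a where "\<forall>k\<le>n. smooth_on UNIV (a k)"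
    and "\<forall>f. smooth_on UNIV f \<longrightarrow> B f = (\<lambda>x. \<Sum>k\<le>n. a k x * (deriv ^^ k) f x)"
    using assms(1) unfolding linear_differential_operator_def by blast
  then show ?thesis
    unfolding linear_differential_operator_def
    by (intro exI[of _ n] exI[of _ a]) (simp add: assms(2))
qed

lemma linear_differential_operator_add:
  assumes "linear_differential_operator A" "linear_differential_operator B"
  shows "linear_differential_operator (\<lambda>f x. A f x + B f x)"
proof -
  obtain n a where a: "\<And>k. k \<le> n \<Longrightarrow> smooth_on UNIV (a k)"
    and A: "\<And>f. smooth_on UNIV f \<Longrightarrow> A f = (\<lambda>x. \<Sum>k\<le>n. a k x * (deriv ^^ k) f x)"
    using assms(1) unfolding linear_differential_operator_def by blast
  obtain m b where b: "\<And>k. k \<le> m \<Longrightarrow> smooth_on UNIV (b k)"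
    and B: "\<And>f. smooth_on UNIV f \<Longrightarrow> B f = (\<lambda>x. \<Sum>k\<le>m. b k x * (deriv ^^ k) f x)"
    using assms(2) unfolding linear_differential_operator_def by blast
  \<comment> \<open>Both coefficient families are padded with zeros to the common order.\<close>
  define c where "c k x = (if k \<le> n then a k x else 0) + (if k \<le> m then b k x else 0)" for k x
  have "smooth_on UNIV (c k)" for k
    unfolding c_def[abs_def] by (intro smooth_intros; cases "k \<le> n"; cases "k \<le> m")
      (auto simp: a b intro: smooth_intros)
  moreover have "(\<lambda>x. A f x + B f x) = (\<lambda>x. \<Sum>k\<le>max n m. c k x * (deriv ^^ k) f x)"
    if "smooth_on UNIV f" for f
  proof
    fix x
    have "(\<Sum>k\<le>n. a k x * (deriv ^^ k) f x) =
        (\<Sum>k\<le>max n m. (if k \<le> n then a k x else 0) * (deriv ^^ k) f x)"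
      by (rule sum.mono_neutral_cong_left) auto
    moreover have "(\<Sum>k\<le>m. b k x * (deriv ^^ k) f x) =
        (\<Sum>k\<le>max n m. (if k \<le> m then b k x else 0) * (deriv ^^ k) f x)"
      by (rule sum.mono_neutral_cong_left) auto
    ultimately show "A f x + B f x = (\<Sum>k\<le>max n m. c k x * (deriv ^^ k) f x)"
      by (simp add: A B that c_def distrib_right sum.distrib)
  qed
  ultimately show ?thesis unfolding linear_differential_operator_def by blast
qed

lemma linear_differential_operator_mult:
  assumes "smooth_on UNIV u" "linear_differential_operator A"
  shows "linear_differential_operator (\<lambda>f x. u x * A f x)"
proof -
  obtain n a where a: "\<And>k. k \<le> n \<Longrightarrow> smooth_on UNIV (a k)"
    and A: "\<And>f. smooth_on UNIV f \<Longrightarrow> A f = (\<lambda>x. \<Sum>k\<le>n. a k x * (deriv ^^ k) f x)"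
    using assms(2) unfolding linear_differential_operator_def by blast
  show ?thesis
    unfolding linear_differential_operator_def
    by (intro exI[of _ n] exI[of _ "\<lambda>k x. u x * a k x"])
      (auto simp: A a sum_distrib_left mult.assoc intro!: smooth_intros assms(1))
qed

lemma linear_differential_operator_monomial:
  assumes "smooth_on UNIV u"
  shows "linear_differential_operator (\<lambda>f x. u x * (deriv ^^ k) f x)"
  unfolding linear_differential_operator_def
proof (intro exI conjI allI impI)
  show "smooth_on UNIV ((\<lambda>j x. if j = k then u x else 0) j)" for j
    by (cases "j = k") (auto intro: assms smooth_intros)
  show "(\<lambda>x. u x * (deriv ^^ k) f x) =
      (\<lambda>x. \<Sum>j\<le>k. (if j = k then u x else 0) * (deriv ^^ j) f x)" for f
    by (simp add: if_distrib[of "\<lambda>c. c * _"] cong: if_cong)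
qed

lemma linear_differential_operator_sum:
  assumes "\<And>i. i \<in> I \<Longrightarrow> linear_differential_operator (A i)"
  shows "linear_differential_operator (\<lambda>f x. \<Sum>i\<in>I. A i f x)"
  using assms
proof (induction I rule: infinite_finite_induct)
  case (insert i I)
  then show ?case by (simp add: linear_differential_operator_add)
qed (use linear_differential_operator_monomial[OF smooth_intros(1)[of 0]] in simp_all)

lemma linear_differential_operator_smooth:
  assumes "linear_differential_operator A" "smooth_on UNIV f"
  shows "smooth_on UNIV (A f)"
proof -
  obtain n a where a: "\<And>k. k \<le> n \<Longrightarrow> smooth_on UNIV (a k)"
    and A: "\<And>f. smooth_on UNIV f \<Longrightarrow> A f = (\<lambda>x. \<Sum>k\<le>n. a k x * (deriv ^^ k) f x)"
    using assms(1) unfolding linear_differential_operator_def by blast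
  show ?thesis
    unfolding A[OF assms(2)]
    by (intro smooth_sum smooth_intros a smooth_deriv_funpow assms(2)) simp
qed

lemma linear_differential_operator_deriv:
  assumes "linear_differential_operator A"
  shows "linear_differential_operator (\<lambda>f. deriv (A f))"
proof -
  obtain n a where a: "\<And>k. k \<le> n \<Longrightarrow> smooth_on UNIV (a k)"
    and A: "\<And>f. smooth_on UNIV f \<Longrightarrow> A f = (\<lambda>x. \<Sum>k\<le>n. a k x * (deriv ^^ k) f x)"
    using assms(1) unfolding linear_differential_operator_def by blast
  show ?thesis
  proof (rule linear_differential_operator_cong)
    show "linear_differential_operator
        (\<lambda>f x. \<Sum>k\<le>n. deriv (a k) x * (deriv ^^ k) f x + a k x * (deriv ^^ Suc k) f x)"
      by (intro linear_differential_operator_sum linear_differential_operator_add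
          linear_differential_operator_monomial smooth_deriv a) auto
    fix f assume f: "smooth_on UNIV f"
    have "((\<lambda>x. \<Sum>k\<le>n. a k x * (deriv ^^ k) f x) has_real_derivative
        (\<Sum>k\<le>n. deriv (a k) x * (deriv ^^ k) f x + a k x * (deriv ^^ Suc k) f x)) (at x)" for x
      by (rule DERIV_sum)
        (use DERIV_mult[OF smooth_has_deriv[OF a] smooth_higher_deriv[OF f]] in
          \<open>auto simp: mult.commute\<close>)
    then show "deriv (A f) =
        (\<lambda>x. \<Sum>k\<le>n. deriv (a k) x * (deriv ^^ k) f x + a k x * (deriv ^^ Suc k) f x)"
      by (auto simp: A[OF f] intro: DERIV_imp_deriv)
  qed
qed

text \<open>Since A is a combination of the D^k, it is enough that each D^k B is a differential
  operator, which follows by applying the product rule k times.\<close>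

lemma linear_differential_operator_comp:
  assumes A: "linear_differential_operator A" and B: "linear_differential_operator B"
  shows "linear_differential_operator (A \<circ> B)"
proof -
  obtain n a where a: "\<And>k. k \<le> n \<Longrightarrow> smooth_on UNIV (a k)"
    and Aa: "\<And>f. smooth_on UNIV f \<Longrightarrow> A f = (\<lambda>x. \<Sum>k\<le>n. a k x * (deriv ^^ k) f x)"
    using A unfolding linear_differential_operator_def by blast
  have D: "linear_differential_operator (\<lambda>f. (deriv ^^ k) (B f))" for k
    by (induction k) (simp_all add: B linear_differential_operator_deriv)
  show ?thesis
  proof (rule linear_differential_operator_cong)
    show "linear_differential_operator (\<lambda>f x. \<Sum>k\<le>n. a k x * (deriv ^^ k) (B f) x)"
      by (intro linear_differential_operator_sum linear_differential_operator_mult a D) simp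
    show "(A \<circ> B) f = (\<lambda>x. \<Sum>k\<le>n. a k x * (deriv ^^ k) (B f) x)" if "smooth_on UNIV f" for f
      using Aa linear_differential_operator_smooth[OF B that] by simp
  qed
qed

subsection \<open>The product of independent variables\<close>

lemma test_functions_integrable:
  assumes "finite_measure M" "f \<in> test_functions" "g \<in> borel_measurable M"
  shows "integrable M (\<lambda>w. f (g w))"
proof -
  obtain B where B: "\<And>x. \<bar>f x\<bar> \<le> B" using test_functions_bounded[OF assms(2)] by blast
  have "f \<in> borel_measurable borel"
    using assms(2) test_functions_smooth smooth_continuous_on borel_measurable_continuous_onI by blast
  then show ?thesis
    using assms(3) B by (intro finite_measure.integrable_const_bound[OF assms(1), where B = B]) auto
qed

section \<open>Localization by the cutoff and passage to the limit\<close>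

text \<open>The expansion of an Euler operator applied in the variable \<open>x\<close> to the product of
  \<open>cutoff (r * x)\<close> and \<open>f (x * y)\<close>, in which \<open>euler i f\<close> is abstracted to \<open>G i\<close>.\<close>

definition localized ::
  "real \<Rightarrow> nat \<Rightarrow> (nat \<Rightarrow> real) \<Rightarrow> (nat \<Rightarrow> real \<Rightarrow> real) \<Rightarrow> real \<Rightarrow> real \<Rightarrow> real" where
  "localized r n c G x y =
     (\<Sum>k\<le>n. \<Sum>j\<le>k. c k * of_nat (k choose j) * euler j cutoff (r * x) * G (k - j) (x * y))"

lemma euler_operator_localized:
  assumes "smooth_on UNIV f"
  shows "euler_operator n c (\<lambda>x. dilation y f x * dilation r cutoff x) x =
    localized r n c (\<lambda>i. euler i f) x y"
proof -
  have "euler k (\<lambda>x. dilation r cutoff x * dilation y f x) x =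
      (\<Sum>j\<le>k. of_nat (k choose j) * euler j cutoff (r * x) * euler (k - j) f (x * y))" for k
    by (simp add: euler_mult smooth_dilation smooth_cutoff assms euler_dilation)
      (simp add: dilation_def mult_ac)
  then show ?thesis
    by (simp add: euler_operator_def localized_def mult.commute[of "dilation y f _"]
        sum_distrib_left mult.assoc)
qed

text \<open>The cutoff enters only through Euler operators evaluated at r x, which are bounded
  functions; no separate power of x or r appears. Hence the bound is uniform in r, as dominated
  convergence needs.\<close>

lemma localized_bounded:
  assumes "\<And>i. \<exists>B. \<forall>z. \<bar>G i z\<bar> \<le> B"
  obtains B where "\<And>r x y. \<bar>localized r n c G x y\<bar> \<le> B"
proof -
  obtain B where B: "\<And>i z. \<bar>G i z\<bar> \<le> B i" using assms by metis
  have "\<exists>C. \<forall>z. \<bar>euler j cutoff z\<bar> \<le> C" for j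
    using test_functions_bounded[OF test_functions_euler[OF test_functions_cutoff]] by metis
  then obtain C where C: "\<And>j z. \<bar>euler j cutoff z\<bar> \<le> C j" by metis
  then have "0 \<le> C j" for j using order_trans[OF abs_ge_zero] by blast
  note C = C this
  have "\<bar>localized r n c G x y\<bar> \<le> (\<Sum>k\<le>n. \<Sum>j\<le>k. \<bar>c k * of_nat (k choose j)\<bar> * C j * B (k - j))"
    for r x y
    unfolding localized_def
    by (intro sum_abs[THEN order_trans] sum_mono)
      (auto simp: abs_mult intro!: mult_mono mult_nonneg_nonneg B C)
  then show ?thesis by (rule that)
qed

text \<open>The cutoff is constant near x, so only its zeroth derivative survives.\<close>

lemma euler_cutoff_near_0: "\<bar>x\<bar> < 1 \<Longrightarrow> euler j cutoff x = (if j = 0 then 1 else 0)"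
proof (cases j)
  case 0
  assume "\<bar>x\<bar> < 1"
  then show ?thesis using 0 by (simp add: euler_def cutoff_eq_1)
next
  case (Suc k)
  assume x: "\<bar>x\<bar> < 1"
  have "(deriv ^^ j) cutoff x = (deriv ^^ j) (\<lambda>x. 1) x"
    by (rule deriv_funpow_eqI[of "ball 0 1"]) (use x in \<open>auto simp: cutoff_eq_1\<close>)
  also have "\<dots> = (deriv ^^ k) (\<lambda>x. 0) x"
    by (simp only: Suc funpow_Suc_right comp_apply deriv_const)
  also have "(deriv ^^ k) (\<lambda>x. 0) = (\<lambda>x. 0 :: real)" by (induction k) auto
  finally show ?thesis using Suc by (simp add: euler_def)
qed

lemma euler_cutoff_eq_0: "2 < \<bar>x\<bar> \<Longrightarrow> euler j cutoff x = 0"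
proof -
  assume x: "2 < \<bar>x\<bar>"
  have 0: "(deriv ^^ j) (\<lambda>x. 0) = (\<lambda>x. 0 :: real)" by (induction j) auto
  have "open {x::real. 2 < \<bar>x\<bar>}" by (intro open_Collect_less continuous_intros)
  then have "(deriv ^^ j) cutoff x = (deriv ^^ j) (\<lambda>x. 0) x"
    by (rule deriv_funpow_eqI) (use x in \<open>auto intro: cutoff_eq_0\<close>)
  then show ?thesis by (simp add: 0 euler_def)
qed

lemma localized_eq:
  assumes "\<bar>r * x\<bar> < 1"
  shows "localized r n c G x y = (\<Sum>k\<le>n. c k * G k (x * y))"
proof -
  have "(\<Sum>j\<le>k. c k * of_nat (k choose j) * euler j cutoff (r * x) * G (k - j) (x * y)) =
      (\<Sum>j\<le>k. if j = 0 then c k * G k (x * y) else 0)" for k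
    by (rule sum.cong) (auto simp: euler_cutoff_near_0[OF assms])
  then show ?thesis by (simp add: localized_def)
qed

text \<open>For fixed x the sequence is eventually constant: once m + 1 exceeds |x|, the cutoff is
  evaluated on its plateau.\<close>

lemma localized_tendsto:
  "(\<lambda>m. localized (1 / real (Suc m)) n c G x y) \<longlonglongrightarrow> (\<Sum>k\<le>n. c k * G k (x * y))"
proof (rule tendsto_eventually)
  obtain N where N: "\<bar>x\<bar> < real N" using reals_Archimedean2 by blast
  have "\<bar>1 / real (Suc m) * x\<bar> < 1" if "m \<ge> N" for m
    using N that by (auto simp: abs_mult field_simps)
  then show "\<forall>\<^sub>F m in sequentially.
      localized (1 / real (Suc m)) n c G x y = (\<Sum>k\<le>n. c k * G k (x * y))"
    by (intro eventually_sequentiallyI[of N] localized_eq)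
qed

lemma localized_measurable:
  assumes "\<And>i. G i \<in> borel_measurable borel"
    and "sets N = sets borel" "sets P = sets borel"
  shows "(\<lambda>(x, y). localized r n c G x y) \<in> borel_measurable (N \<Otimes>\<^sub>M P)"
proof -
  have "euler j cutoff \<in> borel_measurable borel" for j
    by (intro borel_measurable_continuous_onI smooth_continuous_on smooth_euler smooth_cutoff)
  note [measurable] = this assms(1)
  have "(\<lambda>(x, y). localized r n c G x y) \<in> borel_measurable (borel \<Otimes>\<^sub>M borel)"
    unfolding localized_def by measurable
  then show ?thesis
    by (simp add: assms(2,3) cong: measurable_cong_sets sets_pair_measure_cong)
qed

text \<open>The localized expression vanishes for |x| > 2 / r, which tames x^p. This bound blows up
  as r tends to 0 if p > 0; it serves only to justify Fubini's theorem at fixed r.\<close>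

lemma localized_power_bounded:
  assumes "\<And>i. \<exists>B. \<forall>z. \<bar>G i z\<bar> \<le> B" "r > 0"
  obtains B where "\<And>x y. \<bar>x ^ p * localized r n c G x y\<bar> \<le> B"
proof -
  obtain B where B: "\<And>r x y. \<bar>localized r n c G x y\<bar> \<le> B"
    using localized_bounded[of G, OF assms(1)] by blast
  have "\<bar>x ^ p * localized r n c G x y\<bar> \<le> (2 / r) ^ p * B" for x y
  proof (cases "\<bar>x\<bar> \<le> 2 / r")
    case True
    then show ?thesis
      using B[of r x y] assms(2)
      by (auto simp: abs_mult power_abs intro!: mult_mono power_mono)
  next
    case False
    then have "2 < \<bar>r * x\<bar>" using assms(2) by (simp add: abs_mult field_simps)
    then have "localized r n c G x y = 0" by (simp add: localized_def euler_cutoff_eq_0)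
    moreover have "0 \<le> B" using B[of 0 0 0] by linarith
    ultimately show ?thesis using assms(2) by simp
  qed
  then show ?thesis by (rule that)
qed

lemma integral_localized:
  assumes "\<And>i. integrable P (\<lambda>y. G i (x * y))"
  shows "(\<integral>y. localized r n c G x y \<partial>P) =
    (\<Sum>k\<le>n. \<Sum>j\<le>k. c k * of_nat (k choose j) * euler j cutoff (r * x) * (\<integral>y. G (k - j) (x * y) \<partial>P))"
  using assms unfolding localized_def by (simp add: Bochner_Integration.integral_sum)

text \<open>Dominated convergence, with a constant majorant on a probability space.\<close>

lemma integral_localized_tendsto:
  assumes "prob_space N" "prob_space P" "sets N = sets borel" "sets P = sets borel"
    and G: "\<And>i. G i \<in> test_functions"
  shows "(\<lambda>m. \<integral>(x, y). localized (1 / real (Suc m)) n c G x y \<partial>(N \<Otimes>\<^sub>M P)) \<longlonglongrightarrow>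
    (\<integral>(x, y). (\<Sum>k\<le>n. c k * G k (x * y)) \<partial>(N \<Otimes>\<^sub>M P))"
proof -
  interpret N: prob_space N by fact
  interpret P: prob_space P by fact
  interpret NP: pair_prob_space N P ..
  have b: "\<exists>B. \<forall>z. \<bar>G i z\<bar> \<le> B" for i using test_functions_bounded[OF G] by metis
  obtain B where B: "\<And>r x y. \<bar>localized r n c G x y\<bar> \<le> B"
    using localized_bounded[of G, OF b] by blast
  have m: "G i \<in> borel_measurable borel" for i
    using G test_functions_smooth smooth_continuous_on borel_measurable_continuous_onI by blast
  note [measurable] = m
  have "(\<lambda>(x, y). \<Sum>k\<le>n. c k * G k (x * y)) \<in> borel_measurable (borel \<Otimes>\<^sub>M borel)"
    by measurable
  then have "(\<lambda>(x, y). \<Sum>k\<le>n. c k * G k (x * y)) \<in> borel_measurable (N \<Otimes>\<^sub>M P)"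
    by (simp add: assms(3,4) cong: measurable_cong_sets sets_pair_measure_cong)
  then show ?thesis
    by (intro integral_dominated_convergence[where w = "\<lambda>_. B"] localized_measurable m assms(3,4))
      (auto simp: B localized_tendsto simp del: of_nat_Suc split: prod.split)
qed

text \<open>The two variables are treated asymmetrically. The cutoff in x makes the Stein identity
  of \<open>N\<close> available for every y, even y = 0; that of \<open>P\<close> is applied to a
  dilation by x without cutoff, which is a test function only for x nonzero.\<close>

lemma stein_product_identity:
  assumes "prob_space N" "prob_space P" and sets: "sets N = sets borel" "sets P = sets borel"
    and nz: "AE x in N. x \<noteq> 0"
    and stN: "\<And>f. f \<in> test_functions \<Longrightarrow>
      (\<integral>x. euler_operator n\<^sub>1 a\<^sub>1 f x \<partial>N) = (\<integral>x. x ^ p * euler_operator n\<^sub>2 a\<^sub>2 f x \<partial>N)"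
    and stP: "\<And>f. f \<in> test_functions \<Longrightarrow>
      (\<integral>x. euler_operator m\<^sub>1 b\<^sub>1 f x \<partial>P) = (\<integral>x. x ^ p * euler_operator m\<^sub>2 b\<^sub>2 f x \<partial>P)"
    and f: "f \<in> test_functions"
  shows "(\<integral>(x, y). euler_operator n\<^sub>1 a\<^sub>1 (euler_operator m\<^sub>1 b\<^sub>1 f) (x * y) \<partial>(N \<Otimes>\<^sub>M P)) =
    (\<integral>(x, y). (x * y) ^ p * euler_operator n\<^sub>2 a\<^sub>2 (euler_operator m\<^sub>2 b\<^sub>2 f) (x * y) \<partial>(N \<Otimes>\<^sub>M P))"
proof -
  interpret N: prob_space N by fact
  interpret P: prob_space P by fact
  interpret NP: pair_prob_space N P ..
  define F where "F = euler_operator m\<^sub>1 b\<^sub>1 f"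
  \<comment> \<open>\<open>H i\<close> is what the identity of \<open>P\<close> produces from
    \<open>euler i F\<close>, with x^p y^p merged into (x y)^p.\<close>
  define H where "H i = (\<lambda>z. z ^ p * euler i (euler_operator m\<^sub>2 b\<^sub>2 f) z)" for i
  have F: "F \<in> test_functions" unfolding F_def by (rule test_functions_euler_operator[OF f])
  have EF: "euler i F \<in> test_functions" for i by (rule test_functions_euler[OF F])
  have H: "H i \<in> test_functions" for i
    unfolding H_def
    by (intro test_functions_mult test_functions_euler test_functions_euler_operator f
        smooth_power smooth_intros)
  have bdd: "\<exists>B. \<forall>z. \<bar>g z\<bar> \<le> B" if "g \<in> test_functions" for g
    using test_functions_bounded[OF that] by metis
  have meas: "g \<in> borel_measurable borel" if "g \<in> test_functions" for g
    using that test_functions_smooth smooth_continuous_on borel_measurable_continuous_onI by blast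
  have loc_int: "integrable (N \<Otimes>\<^sub>M P) (\<lambda>(x, y). localized r n c G x y)"
    if G: "\<And>i. G i \<in> test_functions" for r n c G
  proof -
    obtain B where "\<And>r x y. \<bar>localized r n c G x y\<bar> \<le> B"
      using localized_bounded[of G, OF bdd[OF G]] by blast
    then show ?thesis
      by (intro NP.integrable_const_bound[of _ B] localized_measurable meas G sets) auto
  qed
  have pow_int: "integrable (N \<Otimes>\<^sub>M P) (\<lambda>(x, y). x ^ p * localized r n c (\<lambda>i. euler i F) x y)"
    if "r > 0" for r n c
  proof -
    obtain B where B: "\<And>x y. \<bar>x ^ p * localized r n c (\<lambda>i. euler i F) x y\<bar> \<le> B"
      using localized_power_bounded[of "\<lambda>i. euler i F", OF bdd[OF EF] \<open>r > 0\<close>] by blast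
    have 1: "fst \<in> borel_measurable (N \<Otimes>\<^sub>M P)"
      using measurable_fst[of N P] by (simp add: sets cong: measurable_cong_sets)
    have "(\<lambda>z. fst z ^ p * (case z of (x, y) \<Rightarrow> localized r n c (\<lambda>i. euler i F) x y))
        \<in> borel_measurable (N \<Otimes>\<^sub>M P)"
      by (intro borel_measurable_times borel_measurable_power 1 localized_measurable meas EF sets)
    then have "(\<lambda>(x, y). x ^ p * localized r n c (\<lambda>i. euler i F) x y) \<in> borel_measurable (N \<Otimes>\<^sub>M P)"
      by (simp add: case_prod_beta)
    then show ?thesis using B by (intro NP.integrable_const_bound[of _ B]) auto
  qed
  have inner_x: "(\<integral>x. localized r n\<^sub>1 a\<^sub>1 (\<lambda>i. euler i F) x y \<partial>N) =
      (\<integral>x. x ^ p * localized r n\<^sub>2 a\<^sub>2 (\<lambda>i. euler i F) x y \<partial>N)" if "r > 0" for r y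
  proof -
    have "(\<lambda>x. dilation y F x * dilation r cutoff x) \<in> test_functions"
      using that by (intro test_functions_mult smooth_dilation test_functions_smooth F
          test_functions_dilation test_functions_cutoff) simp
    from stN[OF this] show ?thesis
      by (simp add: euler_operator_localized test_functions_smooth F)
  qed
  have inner_y: "(\<integral>y. x ^ p * localized r n\<^sub>2 a\<^sub>2 (\<lambda>i. euler i F) x y \<partial>P) =
      (\<integral>y. localized r n\<^sub>2 a\<^sub>2 H x y \<partial>P)" if "x \<noteq> 0" for r x
  proof -
    have y_meas: "(\<lambda>y. x * y) \<in> borel_measurable P"
      by (simp add: sets cong: measurable_cong_sets)
    have int: "integrable P (\<lambda>y. g (x * y))" if "g \<in> test_functions" for g
      by (intro test_functions_integrable that y_meas P.finite_measure_axioms)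
    \<comment> \<open>The identity of \<open>P\<close> is tested on \<open>euler i f\<close> dilated
      by x. Both operators commute with dilations and with \<open>euler i\<close>, which brings out
      \<open>F\<close> and \<open>H i\<close>.\<close>
    have "x ^ p * (\<integral>y. euler i F (x * y) \<partial>P) = (\<integral>y. H i (x * y) \<partial>P)" for i
    proof -
      have s: "smooth_on UNIV f" "smooth_on UNIV (euler i f)"
        using f by (auto intro: smooth_euler test_functions_smooth)
      have "dilation x (euler i f) \<in> test_functions"
        using that by (intro test_functions_dilation test_functions_euler f)
      from stP[OF this] show ?thesis
        by (simp add: euler_operator_dilation s euler_operator_euler H_def F_def)
          (simp add: dilation_def power_mult_distrib mult.assoc)
    qed
    \<comment> \<open>In y the cutoff factors are constants, so the identity may be applied summand
      by summand.\<close>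
    then show ?thesis
      by (simp add: integral_localized int EF H sum_distrib_left mult.left_commute[of "x ^ p"])
  qed
  have eq: "(\<integral>(x, y). localized r n\<^sub>1 a\<^sub>1 (\<lambda>i. euler i F) x y \<partial>(N \<Otimes>\<^sub>M P)) =
      (\<integral>(x, y). localized r n\<^sub>2 a\<^sub>2 H x y \<partial>(N \<Otimes>\<^sub>M P))" if r: "r > 0" for r
  proof -
    have "(\<integral>(x, y). localized r n\<^sub>1 a\<^sub>1 (\<lambda>i. euler i F) x y \<partial>(N \<Otimes>\<^sub>M P)) =
        (\<integral>y. \<integral>x. localized r n\<^sub>1 a\<^sub>1 (\<lambda>i. euler i F) x y \<partial>N \<partial>P)"
      by (rule NP.integral_snd[symmetric]) (rule loc_int[OF EF])
    also have "\<dots> = (\<integral>y. \<integral>x. x ^ p * localized r n\<^sub>2 a\<^sub>2 (\<lambda>i. euler i F) x y \<partial>N \<partial>P)"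
      by (simp add: inner_x r)
    \<comment> \<open>This exchange is what the cutoff is for: with r > 0 fixed the integrand is
      bounded.\<close>
    also have "\<dots> = (\<integral>x. \<integral>y. x ^ p * localized r n\<^sub>2 a\<^sub>2 (\<lambda>i. euler i F) x y \<partial>P \<partial>N)"
      by (rule NP.Fubini_integral) (rule pow_int[OF r])
    also have "\<dots> = (\<integral>x. \<integral>y. localized r n\<^sub>2 a\<^sub>2 H x y \<partial>P \<partial>N)"
    proof (rule integral_cong_AE)
      show "(\<lambda>x. \<integral>y. x ^ p * localized r n\<^sub>2 a\<^sub>2 (\<lambda>i. euler i F) x y \<partial>P) \<in> borel_measurable N"
        using NP.integrable_fst[OF pow_int[OF r]] by (rule borel_measurable_integrable)
      show "(\<lambda>x. \<integral>y. localized r n\<^sub>2 a\<^sub>2 H x y \<partial>P) \<in> borel_measurable N"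
        using NP.integrable_fst[OF loc_int[OF H]] by (rule borel_measurable_integrable)
    qed (use nz inner_y in auto)
    also have "\<dots> = (\<integral>(x, y). localized r n\<^sub>2 a\<^sub>2 H x y \<partial>(N \<Otimes>\<^sub>M P))"
      by (rule NP.integral_fst) (rule loc_int[OF H])
    finally show ?thesis .
  qed
  have "(\<integral>(x, y). (\<Sum>k\<le>n\<^sub>1. a\<^sub>1 k * euler k F (x * y)) \<partial>(N \<Otimes>\<^sub>M P)) =
      (\<integral>(x, y). (\<Sum>k\<le>n\<^sub>2. a\<^sub>2 k * H k (x * y)) \<partial>(N \<Otimes>\<^sub>M P))"
  \<comment> \<open>By \<open>eq\<close> the two localized integrals form a single sequence in m,
    with r = 1 / (m + 1); its two limits must agree.\<close>
  proof (rule LIMSEQ_unique)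
    show "(\<lambda>m. \<integral>(x, y). localized (1 / real (Suc m)) n\<^sub>2 a\<^sub>2 H x y \<partial>(N \<Otimes>\<^sub>M P)) \<longlonglongrightarrow>
        (\<integral>(x, y). (\<Sum>k\<le>n\<^sub>1. a\<^sub>1 k * euler k F (x * y)) \<partial>(N \<Otimes>\<^sub>M P))"
      using integral_localized_tendsto[OF assms(1-4), of "\<lambda>i. euler i F" n\<^sub>1 a\<^sub>1] EF
      by (simp add: eq del: of_nat_Suc)
    show "(\<lambda>m. \<integral>(x, y). localized (1 / real (Suc m)) n\<^sub>2 a\<^sub>2 H x y \<partial>(N \<Otimes>\<^sub>M P)) \<longlonglongrightarrow>
        (\<integral>(x, y). (\<Sum>k\<le>n\<^sub>2. a\<^sub>2 k * H k (x * y)) \<partial>(N \<Otimes>\<^sub>M P))"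
      by (rule integral_localized_tendsto[OF assms(1-4) H])
  qed
  then show ?thesis
    by (simp add: euler_operator_def[of n\<^sub>1] euler_operator_def[of n\<^sub>2] H_def F_def
        sum_distrib_left mult.left_commute)
qed

section \<open>From random variables to their laws, and conclusion\<close>

lemma has_smooth_density_AE_nonzero:
  assumes "has_smooth_density M X"
  shows "AE x in distr M borel X. x \<noteq> 0"
proof -
  obtain g where "distributed M lborel X (\<lambda>x. ennreal (g x))"
    using assms unfolding has_smooth_density_def by blast
  then have "distr M lborel X = density lborel (\<lambda>x. ennreal (g x))"
    and g: "(\<lambda>x. ennreal (g x)) \<in> borel_measurable lborel"
    by (auto simp: distributed_def)
  \<comment> \<open>\<open>borel\<close> and \<open>lborel\<close> have the same measurable sets, so
    the law is the same measure.\<close>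
  moreover have "distr M borel X = distr M lborel X" by (rule distr_cong) auto
  ultimately have "distr M borel X = density lborel (\<lambda>x. ennreal (g x))" by simp
  then show ?thesis
    using AE_lborel_singleton[of "0::real"] by (simp only: AE_density[OF g]) auto
qed

lemma mult_op_funpow: "(mult_op ^^ p) f = (\<lambda>x. x ^ p * f x)"
  by (induction p) (auto simp: mult_op_def)

text \<open>Euler operators and multiplication by x^p preserve test functions, so both parts of the
  Stein operator are separately integrable and the vanishing mean splits into an equation between
  integrals.\<close>

lemma stein_operator_integral_eq:
  assumes "prob_space M" and X: "X \<in> borel_measurable M"
    and "stein_operator M X (L - ((mult_op ^^ p) \<circ> K))"
    and L: "\<And>f. smooth_on UNIV f \<Longrightarrow> L f = euler_operator n a f"
    and K: "\<And>f. smooth_on UNIV f \<Longrightarrow> K f = euler_operator m b f"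
    and f: "f \<in> test_functions"
  shows "(\<integral>x. euler_operator n a f x \<partial>distr M borel X) =
    (\<integral>x. x ^ p * euler_operator m b f x \<partial>distr M borel X)"
proof -
  interpret prob_space M by fact
  have t: "euler_operator n a f \<in> test_functions"
    "(\<lambda>x. x ^ p * euler_operator m b f x) \<in> test_functions"
    by (intro test_functions_mult test_functions_euler_operator f smooth_power smooth_intros)+
  then have m: "euler_operator n a f \<in> borel_measurable borel"
    "(\<lambda>x. x ^ p * euler_operator m b f x) \<in> borel_measurable borel"
    using test_functions_smooth smooth_continuous_on borel_measurable_continuous_onI by blast+
  have "(\<integral>w. euler_operator n a f (X w) - X w ^ p * euler_operator m b f (X w) \<partial>M) = 0"
    using assms(3) f
    by (auto simp: stein_operator_def L K test_functions_smooth[OF f] mult_op_funpow)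
  then show ?thesis
    using test_functions_integrable[OF finite_measure_axioms t(1) X]
      test_functions_integrable[OF finite_measure_axioms t(2) X]
    by (simp add: integral_distr[OF X m(1)] integral_distr[OF X m(2)])
qed

theorem proposition2p4:
  fixes M :: "'w measure"
    and X Y :: "'w \<Rightarrow> real"
    and LX KX LY KY :: "(real \<Rightarrow> real) \<Rightarrow> real \<Rightarrow> real"
    and p :: nat
  assumes "prob_space M"
    and "has_smooth_density M X" and "has_smooth_density M Y"
    and "\<forall>L\<in>{LX, KX, LY, KY}. linear_differential_operator L"
    and "\<forall>L\<in>{LX, KX, LY, KY}. \<forall>K\<in>{LX, KX, LY, KY}. operators_commute L K"
    and "\<forall>L\<in>{LX, KX, LY, KY}. \<forall>a. a \<noteq> 0 \<longrightarrow> operators_commute L (dilation a)"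
    and "stein_operator M X (LX - ((mult_op ^^ p) \<circ> KX))"
    and "stein_operator M Y (LY - ((mult_op ^^ p) \<circ> KY))"
    and "prob_space.indep_var M borel X borel Y"
  shows "stein_operator M (\<lambda>w. X w * Y w) ((LX \<circ> LY) - ((mult_op ^^ p) \<circ> KX \<circ> KY))"
proof -
  interpret prob_space M by fact
  have X: "X \<in> borel_measurable M" and Y: "Y \<in> borel_measurable M"
    and pair: "distr M borel X \<Otimes>\<^sub>M distr M borel Y =
      distr M (borel \<Otimes>\<^sub>M borel) (\<lambda>w. (X w, Y w))"
    using assms(9) by (auto simp: indep_var_distribution_eq)
  have E: "\<exists>n c. \<forall>f. smooth_on UNIV f \<longrightarrow> L f = euler_operator n c f"
    if "L \<in> {LX, KX, LY, KY}" for L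
    using dilation_invariant_operator[of L] assms(4,6) that by metis
  obtain n\<^sub>1 a\<^sub>1 where LX: "\<And>f. smooth_on UNIV f \<Longrightarrow> LX f = euler_operator n\<^sub>1 a\<^sub>1 f"
    using E[of LX] by auto
  obtain n\<^sub>2 a\<^sub>2 where KX: "\<And>f. smooth_on UNIV f \<Longrightarrow> KX f = euler_operator n\<^sub>2 a\<^sub>2 f"
    using E[of KX] by auto
  obtain m\<^sub>1 b\<^sub>1 where LY: "\<And>f. smooth_on UNIV f \<Longrightarrow> LY f = euler_operator m\<^sub>1 b\<^sub>1 f"
    using E[of LY] by auto
  obtain m\<^sub>2 b\<^sub>2 where KY: "\<And>f. smooth_on UNIV f \<Longrightarrow> KY f = euler_operator m\<^sub>2 b\<^sub>2 f"
    using E[of KY] by auto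
  show ?thesis
    unfolding stein_operator_def
  proof (intro conjI ballI)
    \<comment> \<open>Subtraction of M^p is written as addition of a multiple by the smooth function
      -x^p, to fit the closure lemmas.\<close>
    have "linear_differential_operator
        (\<lambda>f x. (LX \<circ> LY) f x + (- (x ^ p)) * (KX \<circ> KY) f x)"
      using assms(4) smooth_intros(5)[OF smooth_intros(1)[of "-1"] smooth_power[OF smooth_intros(2)]]
      by (intro linear_differential_operator_add linear_differential_operator_mult
          linear_differential_operator_comp) auto
    then show "linear_differential_operator ((LX \<circ> LY) - ((mult_op ^^ p) \<circ> KX \<circ> KY))"
      by (rule linear_differential_operator_cong) (auto simp: mult_op_funpow)
  next
    fix f assume f: "f \<in> test_functions"
    define u where "u = euler_operator n\<^sub>1 a\<^sub>1 (euler_operator m\<^sub>1 b\<^sub>1 f)"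
    define v where "v = (\<lambda>z. z ^ p * euler_operator n\<^sub>2 a\<^sub>2 (euler_operator m\<^sub>2 b\<^sub>2 f) z)"
    have uv: "u \<in> test_functions" "v \<in> test_functions"
      unfolding u_def v_def
      by (intro test_functions_mult test_functions_euler_operator f smooth_power smooth_intros)+
    have "smooth_on UNIV f" using f by (rule test_functions_smooth)
    then have A: "((LX \<circ> LY) - ((mult_op ^^ p) \<circ> KX \<circ> KY)) f z = u z - v z" for z
      by (simp add: LX KX LY KY smooth_euler_operator u_def v_def mult_op_funpow)
    have XY: "(\<lambda>w. X w * Y w) \<in> borel_measurable M" using X Y by simp
    have int: "integrable M (\<lambda>w. u (X w * Y w))" "integrable M (\<lambda>w. v (X w * Y w))"
      by (intro test_functions_integrable finite_measure_axioms uv XY)+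
    then show "integrable M (\<lambda>w. ((LX \<circ> LY) - ((mult_op ^^ p) \<circ> KX \<circ> KY)) f (X w * Y w))"
      unfolding A by (rule Bochner_Integration.integrable_diff)
    \<comment> \<open>By independence the product of the laws is the joint law of X and Y, so
      integrals over it are expectations.\<close>
    have pushforward: "(\<integral>(x, y). g (x * y) \<partial>(distr M borel X \<Otimes>\<^sub>M distr M borel Y)) =
        (\<integral>w. g (X w * Y w) \<partial>M)" if "g \<in> test_functions" for g
    proof -
      have [measurable]: "g \<in> borel_measurable borel"
        using that test_functions_smooth smooth_continuous_on borel_measurable_continuous_onI by blast
      show ?thesis
        unfolding pair using X Y by (subst integral_distr) (auto simp: case_prod_beta)
    qed
    have "(\<integral>(x, y). u (x * y) \<partial>(distr M borel X \<Otimes>\<^sub>M distr M borel Y)) =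
        (\<integral>(x, y). v (x * y) \<partial>(distr M borel X \<Otimes>\<^sub>M distr M borel Y))"
      unfolding u_def v_def
      by (intro stein_product_identity prob_space_distr X Y f has_smooth_density_AE_nonzero assms(2)
          stein_operator_integral_eq[OF assms(1) X assms(7) LX KX]
          stein_operator_integral_eq[OF assms(1) Y assms(8) LY KY]) auto
    then have "(\<integral>w. u (X w * Y w) \<partial>M) = (\<integral>w. v (X w * Y w) \<partial>M)"
      by (simp only: pushforward uv)
    then show "(\<integral>w. ((LX \<circ> LY) - ((mult_op ^^ p) \<circ> KX \<circ> KY)) f (X w * Y w) \<partial>M) = 0"
      unfolding A using int by simp
  qed
qed

end
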